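(* Let $G$ be a proper subgroup of $\mathbb{Q}$ and let $S_G$ be the set of primes $p$ such that $G$ is $p$-divisible. If there is no odd prime that divides $p-1$ for every prime $p\notin S_G$, then the Grothendieck ring $K_0(G;+,<)$ of the ordered abelian group $(G;+,<)$ is trivial (i.e. is the zero ring).
   Context: $G$ is $p$-divisible if for every $x\in G$ there is $y\in G$ with $p\cdot y=x$. The order on $G$ is the one induced from $\mathbb{Q}$. Grothendieck ring: for a first-order structure $\mathcal{M}$ with underlying set $M$, let $\mathrm{Def}(\mathcal{M})$ be the family of all subsets of $M^n$ ($n\geq 0$ arbitrary) definable in $\mathcal{M}$ with parameters. Two definable sets are definably isomorphic if there is a definable (with parameters) bijection between them. The Grothendieck group of $\mathcal{M}$ is the abelian group generated by symbols $[X]$, $X\in\mathrm{Def}(\mathcal{M})$, subject to the relations $[X]=[Y]$ whenever $X$ and $Y$ are definably isomorphic, and $[X\cup Y]=[X]+[Y]$ whenever $X\cap Y=\emptyset$. With the multiplication $[X][Y]=[X\times Y]$ it becomes a commutative ring, the Grothendieck ring $K_0(\mathcal{M})$. *)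

theory Defs
  imports
    "HOL-Algebra.Free_Abelian_Groups"
    "HOL-Algebra.Generated_Groups"
    "HOL-Algebra.QuotRing"
    "HOL-Computational_Algebra.Primes"
begin

section \<open>First-order structures and definable sets\<close>

record ('a, 'f, 'r) fo_structure = "'a partial_object" +
  fun_arity :: "'f \<Rightarrow> nat"
  rel_arity :: "'r \<Rightarrow> nat"
  fun_interp :: "'f \<Rightarrow> 'a list \<Rightarrow> 'a"
  rel_interp :: "'r \<Rightarrow> 'a list \<Rightarrow> bool"

datatype 'f fo_term =
    Var nat
  | App 'f "'f fo_term list"

datatype ('f, 'r) fo_formula =
    Eq "'f fo_term" "'f fo_term"
  | Rel 'r "'f fo_term list"
  | Neg "('f, 'r) fo_formula"
  | Conj "('f, 'r) fo_formula" "('f, 'r) fo_formula"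
  | Exists nat "('f, 'r) fo_formula"

primrec wf_fo_term :: "('a, 'f, 'r, 'z) fo_structure_scheme \<Rightarrow> 'f fo_term \<Rightarrow> bool" where
  "wf_fo_term M (Var i) \<longleftrightarrow> True"
| "wf_fo_term M (App f ts) \<longleftrightarrow> length ts = fun_arity M f \<and> list_all (wf_fo_term M) ts"

primrec wf_fo_formula :: "('a, 'f, 'r, 'z) fo_structure_scheme \<Rightarrow> ('f, 'r) fo_formula \<Rightarrow> bool" where
  "wf_fo_formula M (Eq s t) \<longleftrightarrow> wf_fo_term M s \<and> wf_fo_term M t"
| "wf_fo_formula M (Rel r ts) \<longleftrightarrow> length ts = rel_arity M r \<and> list_all (wf_fo_term M) ts"
| "wf_fo_formula M (Neg \<phi>) \<longleftrightarrow> wf_fo_formula M \<phi>"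
| "wf_fo_formula M (Conj \<phi> \<psi>) \<longleftrightarrow> wf_fo_formula M \<phi> \<and> wf_fo_formula M \<psi>"
| "wf_fo_formula M (Exists i \<phi>) \<longleftrightarrow> wf_fo_formula M \<phi>"

primrec eval_fo_term ::
  "('a, 'f, 'r, 'z) fo_structure_scheme \<Rightarrow> (nat \<Rightarrow> 'a) \<Rightarrow> 'f fo_term \<Rightarrow> 'a" where
  "eval_fo_term M e (Var i) = e i"
| "eval_fo_term M e (App f ts) = fun_interp M f (map (eval_fo_term M e) ts)"

primrec sat ::
  "('a, 'f, 'r, 'z) fo_structure_scheme \<Rightarrow> (nat \<Rightarrow> 'a) \<Rightarrow> ('f, 'r) fo_formula \<Rightarrow> bool" where
  "sat M e (Eq s t) \<longleftrightarrow> eval_fo_term M e s = eval_fo_term M e t"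
| "sat M e (Rel r ts) \<longleftrightarrow> rel_interp M r (map (eval_fo_term M e) ts)"
| "sat M e (Neg \<phi>) \<longleftrightarrow> \<not> sat M e \<phi>"
| "sat M e (Conj \<phi> \<psi>) \<longleftrightarrow> sat M e \<phi> \<and> sat M e \<psi>"
| "sat M e (Exists i \<phi>) \<longleftrightarrow> (\<exists>a\<in>carrier M. sat M (e(i := a)) \<phi>)"

text \<open>
  Points of \<open>M\<^sup>n\<close> are lists of length \<open>n\<close>, so that the sets \<open>M\<^sup>n\<close> are disjoint for distinct \<open>n\<close>.
\<close>

definition tuples :: "('a, 'z) partial_object_scheme \<Rightarrow> nat \<Rightarrow> 'a list set" where
  "tuples M n = {xs. length xs = n \<and> set xs \<subseteq> carrier M}"

text \<open>
  Definability with parameters: the variables below \<open>n\<close> range over the point, while the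
  variables from \<open>n\<close> on that occur free in \<open>\<phi>\<close> (finitely many) are given fixed values in \<open>M\<close>
  by \<open>e\<close>; these values are the parameters.
\<close>

definition definable :: "('a, 'f, 'r, 'z) fo_structure_scheme \<Rightarrow> nat \<Rightarrow> 'a list set \<Rightarrow> bool" where
  "definable M n X \<longleftrightarrow>
     (\<exists>\<phi> e. wf_fo_formula M \<phi> \<and> range e \<subseteq> carrier M \<and>
        X = {xs \<in> tuples M n. sat M (\<lambda>i. if i < n then xs ! i else e i) \<phi>})"

definition Def :: "('a, 'f, 'r, 'z) fo_structure_scheme \<Rightarrow> 'a list set set" where
  "Def M = {X. \<exists>n. definable M n X}"

text \<open>
  The graph of \<open>f\<close> from \<open>X \<subseteq> M\<^sup>m\<close> to \<open>Y \<subseteq> M\<^sup>n\<close> is regarded as a subset of \<open>M\<^sup>m\<^sup>+\<^sup>n\<close> by concatenation.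
\<close>

definition def_isomorphic ::
  "('a, 'f, 'r, 'z) fo_structure_scheme \<Rightarrow> 'a list set \<Rightarrow> 'a list set \<Rightarrow> bool" where
  "def_isomorphic M X Y \<longleftrightarrow>
     X \<in> Def M \<and> Y \<in> Def M \<and> (\<exists>f. bij_betw f X Y \<and> {x @ f x | x. x \<in> X} \<in> Def M)"

definition tuple_times :: "'a list set \<Rightarrow> 'a list set \<Rightarrow> 'a list set" where
  "tuple_times X Y = {x @ y | x y. x \<in> X \<and> y \<in> Y}"


section \<open>The Grothendieck ring of a structure\<close>

text \<open>
  The free abelian group on \<open>Def M\<close>, made into a ring by extending the product of sets
  bilinearly. The one is \<open>M\<^sup>0\<close>.
\<close>

definition free_Def_ring ::
  "('a, 'f, 'r, 'z) fo_structure_scheme \<Rightarrow> ('a list set \<Rightarrow>\<^sub>0 int) ring" where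
  "free_Def_ring M =
     \<lparr>carrier = carrier (free_Abelian_group (Def M)),
      monoid.mult = (\<lambda>c d. frag_extend (\<lambda>X. frag_extend (\<lambda>Y. frag_of (tuple_times X Y)) d) c),
      one = frag_of (tuples M 0),
      zero = 0,
      add = (+)\<rparr>"

definition K0_relations ::
  "('a, 'f, 'r, 'z) fo_structure_scheme \<Rightarrow> ('a list set \<Rightarrow>\<^sub>0 int) set" where
  "K0_relations M =
     {frag_of X - frag_of Y | X Y. def_isomorphic M X Y} \<union>
     {frag_of (X \<union> Y) - (frag_of X + frag_of Y) | X Y.
        X \<in> Def M \<and> Y \<in> Def M \<and> X \<union> Y \<in> Def M \<and> X \<inter> Y = {}}"

text \<open>
  The subgroup generated by the relations is an ideal, since multiplying by the class of a
  definable set sends relations to relations; hence the quotient ring below has as additive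
  group the Grothendieck group.
\<close>

definition K0 ::
  "('a, 'f, 'r, 'z) fo_structure_scheme \<Rightarrow> ('a list set \<Rightarrow>\<^sub>0 int) set ring" where
  "K0 M = free_Def_ring M Quot generate (free_Abelian_group (Def M)) (K0_relations M)"


section \<open>Ordered subgroups of the rationals\<close>

definition rat_group :: "rat monoid" where
  "rat_group = \<lparr>carrier = UNIV, monoid.mult = (+), one = 0\<rparr>"

definition p_divisible :: "nat \<Rightarrow> rat set \<Rightarrow> bool" where
  "p_divisible p G \<longleftrightarrow> (\<forall>x\<in>G. \<exists>y\<in>G. of_nat p * y = x)"

definition divisible_primes :: "rat set \<Rightarrow> nat set" where
  "divisible_primes G = {p. prime p \<and> p_divisible p G}"

datatype ordered_group_fun = Plus

datatype ordered_group_rel = Less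

definition ordered_group_structure ::
  "rat set \<Rightarrow> (rat, ordered_group_fun, ordered_group_rel) fo_structure" where
  "ordered_group_structure G =
     \<lparr>carrier = G,
      fun_arity = (\<lambda>_. 2),
      rel_arity = (\<lambda>_. 2),
      fun_interp = (\<lambda>_ xs. xs ! 0 + xs ! 1),
      rel_interp = (\<lambda>_ xs. xs ! 0 < xs ! 1)\<rparr>"

end

theory Submission
  imports Defs
begin

text \<open>
  Write \<open>g = [G]\<close> and \<open>P = [{x \<in> G. 0 < x}]\<close> in the Grothendieck ring.  Since \<open>x \<mapsto> -x\<close> exchanges
  the two half-lines, \<open>g = 2P + 1\<close>.  The open quadrant is the disjoint union of its diagonal, which is
  a copy of the half-line, and of two triangles, each of which a shear maps onto the whole quadrant.
  So \<open>P\<^sup>2 = 2P\<^sup>2 + P\<close>, that is \<open>P\<^sup>2 + P = 0\<close>, and hence \<open>P g = -P\<close> and even \<open>g\<^sup>2 = 1\<close>.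
  Consequently an integer that annihilates \<open>g\<close> annihilates \<open>P = -P g\<close> and therefore
  \<open>1 = g - 2P\<close>.

  Let \<open>p\<close> be a prime for which \<open>G\<close> is not \<open>p\<close>-divisible.  A subgroup of the rationals is locally
  cyclic, so \<open>G\<close> is the disjoint union of \<open>p\<close> cosets of \<open>pG\<close>, all in definable affine bijection with
  \<open>G\<close>.  This gives \<open>g = p g\<close>, hence \<open>p - 1 = 0\<close> in the ring.  The characteristic \<open>n\<close> of the ring
  thus divides \<open>p - 1\<close> for all these primes, and the hypothesis says that \<open>n\<close> has no odd prime divisor.

  It remains to exclude that \<open>n\<close> is even, which is done by showing that \<open>2\<close> is a unit.  Let \<open>p\<close> be the
  least prime for which \<open>G\<close> is not \<open>p\<close>-divisible; if \<open>p = 2\<close> then already \<open>1 = p - 1 = 0\<close>.  All prime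
  factors of \<open>p - 1\<close> are smaller than \<open>p\<close>, so multiplication by \<open>p - 1\<close> is a bijection of \<open>G\<close>.
  Take \<open>c \<in> G\<close> outside \<open>pG\<close>.  The equation \<open>p x = c\<close> has no solution in \<open>G\<close>, so \<open>G\<close> is cut into the
  two parts \<open>c < p x\<close> and \<open>p x < c\<close>, and \<open>x \<mapsto> c - (p - 1) x\<close> maps the first onto the second.  With
  \<open>A\<close> the class of either part, \<open>g = 2A\<close>, and since \<open>g\<^sup>2 = 1\<close>, \<open>2\<close> is a unit.

  The formal argument computes in the free abelian group on the definable sets, modulo the subgroup
  generated by the relations.  Left multiplication by a definable set preserves this subgroup
  (\<open>times_class_K0_kernel\<close>), so the ring is zero as soon as the subgroup contains the
  class of the one-point set \<open>M\<^sup>0\<close> (\<open>K0_trivialI\<close>).  The steps above are \<open>line_class\<close>,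
  \<open>quadrant_class\<close>, \<open>half_plane_class\<close>, \<open>coefficient_one_class\<close>, \<open>one_class_multiple\<close> and
  \<open>halve_one_class\<close>.
\<close>


section \<open>Closure properties of definable sets\<close>

primrec rename_term :: "(nat \<Rightarrow> nat) \<Rightarrow> 'f fo_term \<Rightarrow> 'f fo_term" where
  "rename_term \<rho> (Var i) = Var (\<rho> i)"
| "rename_term \<rho> (App f ts) = App f (map (rename_term \<rho>) ts)"

primrec rename_formula :: "(nat \<Rightarrow> nat) \<Rightarrow> ('f, 'r) fo_formula \<Rightarrow> ('f, 'r) fo_formula" where
  "rename_formula \<rho> (Eq s t) = Eq (rename_term \<rho> s) (rename_term \<rho> t)"
| "rename_formula \<rho> (Rel r ts) = Rel r (map (rename_term \<rho>) ts)"
| "rename_formula \<rho> (Neg \<phi>) = Neg (rename_formula \<rho> \<phi>)"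
| "rename_formula \<rho> (Conj \<phi> \<psi>) = Conj (rename_formula \<rho> \<phi>) (rename_formula \<rho> \<psi>)"
| "rename_formula \<rho> (Exists i \<phi>) = Exists (\<rho> i) (rename_formula \<rho> \<phi>)"

lemma wf_rename_term: "wf_fo_term M t \<Longrightarrow> wf_fo_term M (rename_term \<rho> t)"
  by (induction t) (auto simp: list_all_iff)

lemma wf_rename_formula: "wf_fo_formula M \<phi> \<Longrightarrow> wf_fo_formula M (rename_formula \<rho> \<phi>)"
  by (induction \<phi>) (auto simp: list_all_iff wf_rename_term)

lemma eval_rename_term: "eval_fo_term M e (rename_term \<rho> t) = eval_fo_term M (\<lambda>i. e (\<rho> i)) t"
proof (induction t)
  case (App f ts)
  then have "map (eval_fo_term M e) (map (rename_term \<rho>) ts) = map (eval_fo_term M (\<lambda>i. e (\<rho> i))) ts"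
    by simp
  then show ?case by (simp only: rename_term.simps eval_fo_term.simps)
qed simp

text \<open>
  Bound variables are renamed together with the free ones; injectivity of the renaming is what
  excludes that a free variable is captured.
\<close>

lemma sat_rename_formula:
  assumes "inj \<rho>"
  shows "sat M e (rename_formula \<rho> \<phi>) \<longleftrightarrow> sat M (\<lambda>i. e (\<rho> i)) \<phi>"
proof (induction \<phi> arbitrary: e)
  case (Exists i \<phi>)
  have "(\<lambda>j. (e(\<rho> i := a)) (\<rho> j)) = (\<lambda>j. e (\<rho> j))(i := a)" for a
    using assms by (auto simp: fun_eq_iff inj_eq)
  then show ?case using Exists by (simp only: rename_formula.simps sat.simps)
qed (simp_all add: eval_rename_term comp_def)

lemma definableI:
  assumes "wf_fo_formula M \<phi>" "range e \<subseteq> carrier M"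
    and "\<And>xs. xs \<in> tuples M n \<Longrightarrow> xs \<in> X \<longleftrightarrow> sat M (\<lambda>i. if i < n then xs ! i else e i) \<phi>"
    and "X \<subseteq> tuples M n"
  shows "definable M n X"
  unfolding definable_def using assms by (intro exI[of _ \<phi>] exI[of _ e]) auto

lemma definableE:
  assumes "definable M n X"
  obtains \<phi> e where "wf_fo_formula M \<phi>" "range e \<subseteq> carrier M" "X \<subseteq> tuples M n"
    "\<forall>xs\<in>tuples M n. xs \<in> X \<longleftrightarrow> sat M (\<lambda>i. if i < n then xs ! i else e i) \<phi>"
  using assms unfolding definable_def by blast

lemma definable_subset: "definable M n X \<Longrightarrow> X \<subseteq> tuples M n"
  by (auto elim: definableE)

lemma definable_in_Def: "definable M n X \<Longrightarrow> X \<in> Def M"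
  by (auto simp: Def_def)

lemma definable_eq_coordinates:
  assumes "a \<in> carrier M" "i < n" "j < n"
  shows "definable M n {xs \<in> tuples M n. xs ! i = xs ! j}"
  by (rule definableI[where \<phi> = "Eq (Var i) (Var j)" and e = "\<lambda>_. a"]) (use assms in auto)

lemma definable_tuples: "a \<in> carrier M \<Longrightarrow> definable M n (tuples M n)"
  by (rule definableI[where \<phi> = "Eq (Var 0) (Var 0)" and e = "\<lambda>_. a"]) auto

lemma definable_Diff: "definable M n X \<Longrightarrow> definable M n (tuples M n - X)"
  by (elim definableE, rule definableI[where \<phi> = "Neg \<phi>" for \<phi>]) auto

text \<open>
  The two defining formulas come with their own parameters, which occupy the same variables from
  \<open>n\<close> on.  Renaming moves those of the first formula to the even and those of the second to the odd
  offsets.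
\<close>

lemma definable_Int:
  assumes "definable M n X" "definable M n Y"
  shows "definable M n (X \<inter> Y)"
proof -
  obtain \<phi> d where \<phi>: "wf_fo_formula M \<phi>" "range d \<subseteq> carrier M" "X \<subseteq> tuples M n"
    "\<forall>xs\<in>tuples M n. xs \<in> X \<longleftrightarrow> sat M (\<lambda>i. if i < n then xs ! i else d i) \<phi>"
    using assms(1) by (rule definableE)
  obtain \<psi> e where \<psi>: "wf_fo_formula M \<psi>" "range e \<subseteq> carrier M" "Y \<subseteq> tuples M n"
    "\<forall>xs\<in>tuples M n. xs \<in> Y \<longleftrightarrow> sat M (\<lambda>i. if i < n then xs ! i else e i) \<psi>"
    using assms(2) by (rule definableE)
  define \<rho> where "\<rho> k i = (if i < n then i else n + (2 * (i - n) + k))" for k i :: nat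
  define h where "h j = (if even (j - n) then d (n + (j - n) div 2) else e (n + (j - n) div 2))" for j
  have inj: "inj (\<rho> k)" for k
    by (rule injI) (auto simp: \<rho>_def split: if_splits)
  have "(\<lambda>i. if \<rho> 0 i < n then xs ! \<rho> 0 i else h (\<rho> 0 i)) = (\<lambda>i. if i < n then xs ! i else d i)" for xs
    by (auto simp: \<rho>_def h_def fun_eq_iff)
  moreover have "(\<lambda>i. if \<rho> (Suc 0) i < n then xs ! \<rho> (Suc 0) i else h (\<rho> (Suc 0) i))
      = (\<lambda>i. if i < n then xs ! i else e i)" for xs
    by (auto simp: \<rho>_def h_def fun_eq_iff)
  moreover have "range h \<subseteq> carrier M"
    using \<phi>(2) \<psi>(2) by (auto simp: h_def)
  ultimately show ?thesis
    using \<phi> \<psi> inj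
    by (intro definableI[where \<phi> = "Conj (rename_formula (\<rho> 0) \<phi>) (rename_formula (\<rho> (Suc 0)) \<psi>)" and e = h])
      (auto simp: wf_rename_formula sat_rename_formula)
qed

lemma definable_Un:
  assumes "definable M n X" "definable M n Y"
  shows "definable M n (X \<union> Y)"
proof -
  have "X \<union> Y = tuples M n - ((tuples M n - X) \<inter> (tuples M n - Y))"
    using assms definable_subset by blast
  then show ?thesis using assms by (simp only: definable_Diff definable_Int)
qed

lemma definable_empty: "a \<in> carrier M \<Longrightarrow> definable M n {}"
  using definable_Diff[OF definable_tuples[of a M n]] by simp

lemma definable_all_less:
  fixes k :: nat
  assumes "a \<in> carrier M" "\<And>i. i < k \<Longrightarrow> definable M n {xs \<in> tuples M n. Q i xs}"
  shows "definable M n {xs \<in> tuples M n. \<forall>i<k. Q i xs}"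
  using assms(2)
proof (induction k)
  case 0
  then show ?case using definable_tuples[OF assms(1)] by simp
next
  case (Suc k)
  have "{xs \<in> tuples M n. \<forall>i<Suc k. Q i xs} =
      {xs \<in> tuples M n. \<forall>i<k. Q i xs} \<inter> {xs \<in> tuples M n. Q k xs}"
    by (auto simp: less_Suc_eq)
  then show ?case using Suc by (simp add: definable_Int)
qed

text \<open>
  Cylinders, products and permutations of coordinates are all obtained from this lemma.  Injectivity of
  \<open>\<sigma>\<close> is needed to rename variables; coincidences between coordinates are expressed by intersecting with
  the sets of \<open>definable_eq_coordinates\<close>.
\<close>

lemma definable_pullback:
  assumes X: "definable M m X" and "inj_on \<sigma> {..<m}" "\<And>i. i < m \<Longrightarrow> \<sigma> i < n"
  shows "definable M n {xs \<in> tuples M n. map (\<lambda>i. xs ! \<sigma> i) [0..<m] \<in> X}"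
proof -
  obtain \<phi> e where \<phi>: "wf_fo_formula M \<phi>" "range e \<subseteq> carrier M" "X \<subseteq> tuples M m"
    "\<forall>xs\<in>tuples M m. xs \<in> X \<longleftrightarrow> sat M (\<lambda>i. if i < m then xs ! i else e i) \<phi>"
    using X by (rule definableE)
  define \<rho> where "\<rho> i = (if i < m then \<sigma> i else n + (i - m))" for i
  have inj: "inj \<rho>"
  proof (rule injI)
    fix i j assume "\<rho> i = \<rho> j"
    then show "i = j" using inj_onD[OF assms(2), of i j] assms(3)[of i] assms(3)[of j]
      by (auto simp: \<rho>_def split: if_splits)
  qed
  have mem: "map (\<lambda>i. xs ! \<sigma> i) [0..<m] \<in> tuples M m" if "xs \<in> tuples M n" for xs
    using that assms(3) by (auto simp: tuples_def)
  have "(\<lambda>i. if \<rho> i < n then xs ! \<rho> i else e (\<rho> i - n + m))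
      = (\<lambda>i. if i < m then map (\<lambda>i. xs ! \<sigma> i) [0..<m] ! i else e i)" for xs
    using assms(3) by (auto simp: \<rho>_def fun_eq_iff)
  then show ?thesis
    using \<phi> inj mem
    by (intro definableI[where \<phi> = "rename_formula \<rho> \<phi>" and e = "\<lambda>i. e (i - n + m)"])
      (auto simp: wf_rename_formula sat_rename_formula)
qed

text \<open>
  In the defining formula of \<open>X\<close> the last coordinate is the variable \<open>n\<close>, so it suffices to quantify
  over it; the parameters keep their places.
\<close>

lemma definable_projection:
  assumes X: "definable M (Suc n) X"
  shows "definable M n {xs \<in> tuples M n. \<exists>a\<in>carrier M. xs @ [a] \<in> X}"
proof -
  obtain \<phi> e where \<phi>: "wf_fo_formula M \<phi>" "range e \<subseteq> carrier M" "X \<subseteq> tuples M (Suc n)"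
    "\<forall>xs\<in>tuples M (Suc n).
      xs \<in> X \<longleftrightarrow> sat M (\<lambda>i. if i < Suc n then xs ! i else e i) \<phi>"
    using X by (rule definableE)
  have "xs @ [a] \<in> X \<longleftrightarrow> sat M ((\<lambda>i. if i < n then xs ! i else e i)(n := a)) \<phi>"
    if "xs \<in> tuples M n" "a \<in> carrier M" for xs a
  proof -
    have "(\<lambda>i. if i < n then xs ! i else e i)(n := a)
        = (\<lambda>i. if i < Suc n then (xs @ [a]) ! i else e i)"
      using that by (auto simp: fun_eq_iff nth_append tuples_def)
    moreover have "xs @ [a] \<in> tuples M (Suc n)" using that by (auto simp: tuples_def)
    ultimately show ?thesis using \<phi>(4) by (simp only:)
  qed
  then show ?thesis
    using \<phi> by (intro definableI[where \<phi> = "Exists n \<phi>" and e = e]) auto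
qed

lemma map_nth_shift: "length xs = k + n \<Longrightarrow> map (\<lambda>i. xs ! (k + i)) [0..<n] = drop k xs"
  by (rule nth_equalityI) auto

lemma map_nth_prefix: "m \<le> length xs \<Longrightarrow> map (\<lambda>i. xs ! i) [0..<m] = take m xs"
  by (rule nth_equalityI) auto

lemma tuple_times_eq:
  assumes "X \<subseteq> tuples M m" "Y \<subseteq> tuples M n"
  shows "tuple_times X Y = {zs \<in> tuples M (m + n). take m zs \<in> X \<and> drop m zs \<in> Y}" (is "_ = ?R")
proof (intro equalityI subsetI)
  fix zs assume "zs \<in> tuple_times X Y"
  then show "zs \<in> ?R" using assms by (auto simp: tuple_times_def tuples_def subset_iff)
next
  fix zs assume "zs \<in> ?R"
  then show "zs \<in> tuple_times X Y" unfolding tuple_times_def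
    by (metis (mono_tags, lifting) append_take_drop_id mem_Collect_eq)
qed

lemma definable_tuple_times:
  assumes "definable M m X" "definable M n Y"
  shows "definable M (m + n) (tuple_times X Y)"
proof -
  have "tuple_times X Y =
      {zs \<in> tuples M (m + n). map (\<lambda>i. zs ! i) [0..<m] \<in> X} \<inter>
      {zs \<in> tuples M (m + n). map (\<lambda>i. zs ! (m + i)) [0..<n] \<in> Y}"
    using tuple_times_eq[OF definable_subset[OF assms(1)] definable_subset[OF assms(2)]]
    by (auto simp: map_nth_shift map_nth_prefix tuples_def)
  then show ?thesis
    using definable_Int definable_pullback[OF assms(1), of "\<lambda>i. i" "m + n"]
      definable_pullback[OF assms(2), of "\<lambda>i. m + i" "m + n"]
    by (auto simp: inj_on_def)
qed

lemma tuple_times_in_Def: "X \<in> Def M \<Longrightarrow> Y \<in> Def M \<Longrightarrow> tuple_times X Y \<in> Def M"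
  unfolding Def_def using definable_tuple_times by blast

lemma DefE:
  assumes "X \<in> Def M"
  obtains n where "definable M n X" "X \<subseteq> tuples M n"
  using assms definable_subset unfolding Def_def by blast

lemma def_isomorphicI:
  assumes "X \<in> Def M" "Y \<in> Def M" "bij_betw f X Y" "{x @ f x | x. x \<in> X} \<in> Def M"
  shows "def_isomorphic M X Y"
  using assms unfolding def_isomorphic_def by blast

text \<open>
  The bijection is the identity on \<open>X\<close> times the given one.  Its graph consists of the points
  \<open>x @ y @ x' @ z\<close> with \<open>x \<in> X\<close>, \<open>y @ z\<close> in the given graph and \<open>x = x'\<close>; each of the three
  conditions is a pullback or a conjunction of equations between coordinates.
\<close>

lemma def_isomorphic_tuple_times:
  assumes ne: "a \<in> carrier M" and X: "X \<in> Def M" and iso: "def_isomorphic M Y Z"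
  shows "def_isomorphic M (tuple_times X Y) (tuple_times X Z)"
proof -
  obtain f where Y: "Y \<in> Def M" and Z: "Z \<in> Def M" and bij: "bij_betw f Y Z"
    and graph: "{y @ f y | y. y \<in> Y} \<in> Def M" (is "?\<Gamma> \<in> _")
    using iso by (auto simp: def_isomorphic_def)
  obtain m where m: "definable M m X" "X \<subseteq> tuples M m" using X by (rule DefE)
  obtain k where k: "definable M k Y" "Y \<subseteq> tuples M k" using Y by (rule DefE)
  obtain l where l: "definable M l Z" "Z \<subseteq> tuples M l" using Z by (rule DefE)
  obtain d where d: "definable M d ?\<Gamma>" "?\<Gamma> \<subseteq> tuples M d" using graph by (rule DefE)
  define F where "F zs = take m zs @ f (drop m zs)" for zs
  have F: "F (x @ y) = x @ f y" if "x \<in> X" for x y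
    using that m(2) by (auto simp: F_def tuples_def)
  have fZ: "f y \<in> Z" if "y \<in> Y" for y using that bij bij_betwE by metis
  have inj: "inj_on F (tuple_times X Y)"
  proof (rule inj_onI)
    fix u v assume u: "u \<in> tuple_times X Y" and v: "v \<in> tuple_times X Y" and eq: "F u = F v"
    obtain x y where x: "u = x @ y" "x \<in> X" "y \<in> Y" using u by (auto simp: tuple_times_def)
    obtain x' y' where x': "v = x' @ y'" "x' \<in> X" "y' \<in> Y" using v by (auto simp: tuple_times_def)
    have "length x = length x'" using x x' m(2) by (auto simp: tuples_def)
    with eq have "x = x'" "f y = f y'" using x x' F by auto
    then show "u = v" using x x' bij by (auto simp: bij_betw_def inj_on_def)
  qed
  have image: "F ` tuple_times X Y = tuple_times X Z"
  proof (intro equalityI subsetI)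
    fix w assume "w \<in> tuple_times X Z"
    then obtain x z where w: "w = x @ z" "x \<in> X" "z \<in> Z" by (auto simp: tuple_times_def)
    then obtain y where "y \<in> Y" "z = f y" using bij by (auto simp: bij_betw_def)
    then have "w = F (x @ y)" "x @ y \<in> tuple_times X Y" using w F by (auto simp: tuple_times_def)
    then show "w \<in> F ` tuple_times X Y" by blast
  next
    fix w assume "w \<in> F ` tuple_times X Y"
    then obtain x y where "x \<in> X" "y \<in> Y" "w = x @ f y" using F by (auto simp: tuple_times_def)
    then show "w \<in> tuple_times X Z" using fZ by (auto simp: tuple_times_def)
  qed
  have "{w @ F w | w. w \<in> tuple_times X Y} \<in> Def M"
  proof (cases "Y = {}")
    case True
    then show ?thesis
      using definable_in_Def[OF definable_empty[OF ne]] by (simp add: tuple_times_def)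
  next
    case False
    then obtain y where "y \<in> Y" by blast
    then have "y @ f y \<in> tuples M d" "y \<in> tuples M k" "f y \<in> tuples M l"
      using d(2) k(2) l(2) fZ by auto
    \<comment> \<open>A nonempty definable set determines its dimension.\<close>
    then have dkl: "d = k + l" by (simp add: tuples_def)
    define n where "n = m + k + (m + l)"
    \<comment> \<open>\<open>\<sigma>\<close> picks out the blocks \<open>y\<close> and \<open>z\<close> of \<open>x @ y @ x' @ z\<close>.\<close>
    define \<sigma> where "\<sigma> i = (if i < k then m + i else i + 2 * m)" for i
    have n_app: "zs \<in> tuples M n \<longleftrightarrow> (\<exists>x y x' z. zs = x @ y @ x' @ z \<and>
        x \<in> tuples M m \<and> y \<in> tuples M k \<and> x' \<in> tuples M m \<and> z \<in> tuples M l)" for zs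
    proof
      assume *: "zs \<in> tuples M n"
      have "zs = take m zs @ take k (drop m zs) @ take m (drop (m + k) zs) @ drop (m + k + m) zs"
        using append_take_drop_id[of m zs] append_take_drop_id[of k "drop m zs"]
          append_take_drop_id[of m "drop (m + k) zs"]
        by (simp only: drop_drop add.commute[of _ m] add.assoc add.left_commute)
      moreover have "take m zs \<in> tuples M m" "take k (drop m zs) \<in> tuples M k"
        "take m (drop (m + k) zs) \<in> tuples M m" "drop (m + k + m) zs \<in> tuples M l"
        using * by (auto simp: tuples_def n_def dest!: in_set_takeD in_set_dropD)
      ultimately show "\<exists>x y x' z. zs = x @ y @ x' @ z \<and>
        x \<in> tuples M m \<and> y \<in> tuples M k \<and> x' \<in> tuples M m \<and> z \<in> tuples M l" by blast
    qed (auto simp: tuples_def n_def)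
    have pull: "map (\<lambda>i. (x @ y @ x' @ z) ! \<sigma> i) [0..<d] = y @ z"
      "map (\<lambda>i. (x @ y @ x' @ z) ! i) [0..<m] = x"
      "(\<forall>i<m. (x @ y @ x' @ z) ! i = (x @ y @ x' @ z) ! (m + k + i)) \<longleftrightarrow> x = x'"
      if "x \<in> tuples M m" "y \<in> tuples M k" "x' \<in> tuples M m" "z \<in> tuples M l" for x y x' z
    proof -
      have len: "length x = m" "length y = k" "length x' = m" "length z = l"
        using that by (auto simp: tuples_def)
      show "map (\<lambda>i. (x @ y @ x' @ z) ! \<sigma> i) [0..<d] = y @ z"
        using len by (intro nth_equalityI) (auto simp: dkl \<sigma>_def nth_append)
      show "map (\<lambda>i. (x @ y @ x' @ z) ! i) [0..<m] = x"
        using len by (intro nth_equalityI) (auto simp: nth_append)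
      show "(\<forall>i<m. (x @ y @ x' @ z) ! i = (x @ y @ x' @ z) ! (m + k + i)) \<longleftrightarrow> x = x'"
        using len by (auto simp: nth_append list_eq_iff_nth_eq)
    qed
    have "{w @ F w | w. w \<in> tuple_times X Y} =
        {zs \<in> tuples M n. map (\<lambda>i. zs ! i) [0..<m] \<in> X} \<inter>
        {zs \<in> tuples M n. map (\<lambda>i. zs ! \<sigma> i) [0..<d] \<in> ?\<Gamma>} \<inter>
        {zs \<in> tuples M n. \<forall>i<m. zs ! i = zs ! (m + k + i)}" (is "?L = ?R")
    proof (intro equalityI subsetI)
      fix zs assume "zs \<in> ?L"
      then obtain x y where xy: "zs = x @ y @ x @ f y" "x \<in> X" "y \<in> Y"
        using F by (auto simp: tuple_times_def)
      then have "x \<in> tuples M m" "y \<in> tuples M k" "f y \<in> tuples M l"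
        using m(2) k(2) l(2) fZ by auto
      then show "zs \<in> ?R" using xy pull[of x y x "f y"] n_app[of zs] by auto
    next
      fix zs assume R: "zs \<in> ?R"
      then obtain x y x' z where zs: "zs = x @ y @ x' @ z"
        and t: "x \<in> tuples M m" "y \<in> tuples M k" "x' \<in> tuples M m" "z \<in> tuples M l"
        using n_app[of zs] by blast
      from R have x: "x \<in> X" "x' = x" and "y @ z \<in> ?\<Gamma>" using pull[OF t] zs by auto
      then obtain y' where y': "y @ z = y' @ f y'" "y' \<in> Y" by blast
      then have "length y' = length y" using k(2) t by (auto simp: tuples_def)
      then have "y \<in> Y" "z = f y" using y' by auto
      then have "x @ y \<in> tuple_times X Y" "zs = (x @ y) @ F (x @ y)"
        using x zs F[of x y] by (auto simp: tuple_times_def)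
      then show "zs \<in> ?L" by blast
    qed
    moreover have "definable M n {zs \<in> tuples M n. map (\<lambda>i. zs ! i) [0..<m] \<in> X}"
      using definable_pullback[OF m(1), of "\<lambda>i. i" n] by (simp add: n_def inj_on_def)
    moreover have "definable M n {zs \<in> tuples M n. map (\<lambda>i. zs ! \<sigma> i) [0..<d] \<in> ?\<Gamma>}"
      by (rule definable_pullback[OF d(1)]) (auto simp: n_def dkl \<sigma>_def inj_on_def split: if_splits)
    moreover have "definable M n {zs \<in> tuples M n. \<forall>i<m. zs ! i = zs ! (m + k + i)}"
      by (rule definable_all_less[OF ne], rule definable_eq_coordinates[OF ne]) (auto simp: n_def)
    ultimately have "definable M n {w @ F w | w. w \<in> tuple_times X Y}"
      by (simp only: definable_Int)
    then show ?thesis by (rule definable_in_Def)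
  qed
  then show ?thesis
    unfolding def_isomorphic_def bij_betw_def
    using inj image tuple_times_in_Def[OF X Y] tuple_times_in_Def[OF X Z] by blast
qed


section \<open>The subgroup of relations\<close>

definition K0_kernel where
  "K0_kernel M = generate (free_Abelian_group (Def M)) (K0_relations M)"

lemma K0_relations_subset: "K0_relations M \<subseteq> carrier (free_Abelian_group (Def M))"
proof
  fix c assume "c \<in> K0_relations M"
  then consider X Y where "c = frag_of X - frag_of Y" "X \<in> Def M" "Y \<in> Def M"
    | X Y where "c = frag_of (X \<union> Y) - (frag_of X + frag_of Y)"
        "X \<in> Def M" "Y \<in> Def M" "X \<union> Y \<in> Def M"
    by (auto simp: K0_relations_def def_isomorphic_def)
  then show "c \<in> carrier (free_Abelian_group (Def M))"
  proof cases
    case 1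
    then show ?thesis using keys_diff[of "frag_of X" "frag_of Y"] by auto
  next
    case 2
    then show ?thesis
      using keys_diff[of "frag_of (X \<union> Y)" "frag_of X + frag_of Y"] keys_add[of "frag_of X" "frag_of Y"]
      by auto
  qed
qed

lemma K0_kernel_subgroup: "subgroup (K0_kernel M) (free_Abelian_group (Def M))"
  unfolding K0_kernel_def
  by (rule group.generate_is_subgroup[OF group_free_Abelian_group K0_relations_subset])

lemma K0_kernel_add: "c \<in> K0_kernel M \<Longrightarrow> d \<in> K0_kernel M \<Longrightarrow> c + d \<in> K0_kernel M"
  using subgroup.m_closed[OF K0_kernel_subgroup] by fastforce

lemma K0_kernel_zero: "0 \<in> K0_kernel M"
  using subgroup.one_closed[OF K0_kernel_subgroup] by fastforce

lemma K0_kernel_uminus: "c \<in> K0_kernel M \<Longrightarrow> - c \<in> K0_kernel M"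
  using subgroup.m_inv_closed[OF K0_kernel_subgroup, of c M] subgroup.subset[OF K0_kernel_subgroup, of M]
  by (auto simp: subset_iff)

lemma K0_kernel_diff: "c \<in> K0_kernel M \<Longrightarrow> d \<in> K0_kernel M \<Longrightarrow> c - d \<in> K0_kernel M"
  using K0_kernel_add[OF _ K0_kernel_uminus] by fastforce

lemma K0_kernel_cmul: "c \<in> K0_kernel M \<Longrightarrow> frag_cmul k c \<in> K0_kernel M"
proof (induction k rule: int_induct[of _ 0])
  case base
  then show ?case by (simp add: K0_kernel_zero)
next
  case (step1 i)
  then show ?case by (simp add: frag_cmul_distrib K0_kernel_add)
next
  case (step2 i)
  then show ?case by (simp add: frag_cmul_diff_distrib K0_kernel_diff)
qed

lemma K0_kernel_iso: "def_isomorphic M X Y \<Longrightarrow> frag_of X - frag_of Y \<in> K0_kernel M"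
  unfolding K0_kernel_def by (rule generate.incl) (auto simp: K0_relations_def)

lemma K0_kernel_Un:
  assumes "definable M n X" "definable M n Y" "X \<inter> Y = {}"
  shows "frag_of (X \<union> Y) - (frag_of X + frag_of Y) \<in> K0_kernel M"
proof -
  have "X \<in> Def M" "Y \<in> Def M" "X \<union> Y \<in> Def M"
    using assms(1,2) definable_Un[OF assms(1,2)] definable_in_Def by blast+
  then show ?thesis
    unfolding K0_kernel_def using assms(3)
    by (intro generate.incl) (unfold K0_relations_def, blast)
qed

text \<open>
  Multiplication by \<open>[X]\<close> from the left, before passing to the quotient by the relations.
\<close>

definition times_class :: "'a list set \<Rightarrow> ('a list set \<Rightarrow>\<^sub>0 int) \<Rightarrow> ('a list set \<Rightarrow>\<^sub>0 int)" where
  "times_class X = frag_extend (\<lambda>Y. frag_of (tuple_times X Y))"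

lemma times_class_simps:
  "times_class X (frag_of Y) = frag_of (tuple_times X Y)"
  "times_class X (c + d) = times_class X c + times_class X d"
  "times_class X (c - d) = times_class X c - times_class X d"
  "times_class X (frag_cmul k c) = frag_cmul k (times_class X c)"
  by (simp_all add: times_class_def frag_extend_add frag_extend_diff frag_extend_cmul)

text \<open>
  A relation is sent to a relation: products with \<open>X\<close> preserve definable isomorphism, and they preserve
  disjoint unions because all points of \<open>X\<close> have the same length, so that the two factors of a
  concatenation can be recovered.
\<close>

lemma times_class_K0_kernel:
  assumes ne: "a \<in> carrier M" and X: "X \<in> Def M" and c: "c \<in> K0_kernel M"
  shows "times_class X c \<in> K0_kernel M"
proof -
  have rel: "times_class X h \<in> K0_kernel M" if "h \<in> K0_relations M" for h
    using that unfolding K0_relations_def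
  proof (elim UnE CollectE exE conjE)
    fix Y Z assume "h = frag_of Y - frag_of Z" "def_isomorphic M Y Z"
    then show ?thesis
      using K0_kernel_iso[OF def_isomorphic_tuple_times[OF ne X]] by (simp add: times_class_simps)
  next
    fix Y Z
    assume h: "h = frag_of (Y \<union> Z) - (frag_of Y + frag_of Z)"
      and D: "Y \<in> Def M" "Z \<in> Def M" "Y \<union> Z \<in> Def M" and disj: "Y \<inter> Z = {}"
    obtain m where m: "X \<subseteq> tuples M m" using X by (rule DefE)
    have un: "tuple_times X (Y \<union> Z) = tuple_times X Y \<union> tuple_times X Z"
      by (auto simp: tuple_times_def)
    have "tuple_times X Y \<inter> tuple_times X Z = {}"
    proof (rule ccontr)
      assume "tuple_times X Y \<inter> tuple_times X Z \<noteq> {}"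
      then obtain x y x' z where *: "x @ y = x' @ z" "x \<in> X" "x' \<in> X" "y \<in> Y" "z \<in> Z"
        by (auto simp: tuple_times_def)
      then have "length x = length x'" using m by (auto simp: tuples_def)
      then show False using * disj by auto
    qed
    moreover have "tuple_times X Y \<in> Def M" "tuple_times X Z \<in> Def M"
      "tuple_times X Y \<union> tuple_times X Z \<in> Def M"
      using tuple_times_in_Def[OF X] D un by metis+
    ultimately have "times_class X h \<in> K0_relations M"
      unfolding h times_class_simps un K0_relations_def by blast
    then show ?thesis unfolding K0_kernel_def by (rule generate.incl)
  qed
  show ?thesis
    using c unfolding K0_kernel_def
  proof (induction rule: generate.induct)
    case one
    then show ?case using K0_kernel_zero[of M] by (simp add: times_class_def K0_kernel_def)
  next
    case (incl h)
    then show ?case using rel by (simp add: K0_kernel_def)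
  next
    case (inv h)
    then have "Poly_Mapping.keys h \<subseteq> Def M" using K0_relations_subset by fastforce
    then show ?case using K0_kernel_uminus[OF rel[OF inv]]
      by (simp add: times_class_def K0_kernel_def frag_extend_minus)
  next
    case (eng h1 h2)
    then show ?case using K0_kernel_add by (simp add: times_class_simps K0_kernel_def)
  qed
qed

lemma frag_cmul_diff_distrib2: "frag_cmul k (c - d) = frag_cmul k c - frag_cmul k d"
  by (rule poly_mapping_eqI) (simp add: lookup_minus right_diff_distrib)

text \<open>
  The point \<open>M\<^sup>0\<close> is the unit of the product, so if its class vanishes then so do the classes of all
  definable sets, and these generate the ring.
\<close>

lemma K0_trivialI:
  assumes ne: "a \<in> carrier M" and one: "frag_of (tuples M 0) \<in> K0_kernel M"
  shows "carrier (K0 M) = {\<zero>\<^bsub>K0 M\<^esub>}"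
proof -
  have gen: "frag_of X \<in> K0_kernel M" if "X \<in> Def M" for X
    using times_class_K0_kernel[OF ne that one]
    by (simp add: times_class_simps tuple_times_def tuples_def)
  have all: "c \<in> K0_kernel M" if "Poly_Mapping.keys c \<subseteq> Def M" for c
    by (rule free_Abelian_group_induct[OF that]) (auto simp: K0_kernel_zero K0_kernel_diff gen)
  have sub: "\<And>c. c \<in> K0_kernel M \<Longrightarrow> Poly_Mapping.keys c \<subseteq> Def M"
    using subgroup.subset[OF K0_kernel_subgroup] by fastforce
  have coset: "(\<Union>h\<in>K0_kernel M. {h + c}) = K0_kernel M" if "Poly_Mapping.keys c \<subseteq> Def M" for c
  proof (intro equalityI subsetI)
    fix d assume "d \<in> K0_kernel M"
    then have "d - c \<in> K0_kernel M" using all[OF that] K0_kernel_diff by blast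
    then show "d \<in> (\<Union>h\<in>K0_kernel M. {h + c})" by force
  qed (use all[OF that] K0_kernel_add in blast)
  have "0 \<in> carrier (free_Abelian_group (Def M))"
    by simp
  then have "carrier (free_Abelian_group (Def M)) \<noteq> {}"
    by blast
  then show ?thesis
    unfolding K0_def K0_kernel_def[symmetric] FactRing_def A_RCOSETS_def' a_r_coset_def'
    using coset sub K0_kernel_zero[of M]
    by (auto simp: free_Def_ring_def)
qed


section \<open>Definable sets in ordered subgroups of the rationals\<close>

text \<open>
  \<open>multiple n t\<close> is the term for \<open>(n + 1) t\<close>: the language has no symbol for zero, so there is no
  term for the empty sum.
\<close>

primrec multiple :: "nat \<Rightarrow> ordered_group_fun fo_term \<Rightarrow> ordered_group_fun fo_term" where
  "multiple 0 t = t"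
| "multiple (Suc n) t = App Plus [t, multiple n t]"

definition points :: "'a set \<Rightarrow> 'a list set" where
  "points A = (\<lambda>x. [x]) ` A"

lemma points_iff [simp]: "[x] \<in> points A \<longleftrightarrow> x \<in> A"
  by (auto simp: points_def)

lemma points_Un: "points (A \<union> B) = points A \<union> points B"
  by (auto simp: points_def)

lemma points_Int_empty: "A \<inter> B = {} \<Longrightarrow> points A \<inter> points B = {}"
  by (auto simp: points_def)

lemma tuple_times_points: "tuple_times (points A) (points B) = {[x, y] | x y. x \<in> A \<and> y \<in> B}"
proof -
  have "[x, y] \<in> tuple_times (points A) (points B)" if "x \<in> A" "y \<in> B" for x y
    using that unfolding tuple_times_def by (intro CollectI exI[of _ "[x]"] exI[of _ "[y]"]) simp
  then show ?thesis
    by (auto simp: tuple_times_def points_def)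
qed

lemma tuples_Suc: "xs \<in> tuples M (Suc n) \<longleftrightarrow> (\<exists>x ys. xs = x # ys \<and> x \<in> carrier M \<and> ys \<in> tuples M n)"
  by (auto simp: tuples_def length_Suc_conv)

lemma tuples_numeral: "xs \<in> tuples M (numeral k) \<longleftrightarrow>
    (\<exists>x ys. xs = x # ys \<and> x \<in> carrier M \<and> ys \<in> tuples M (pred_numeral k))"
  by (simp only: numeral_eq_Suc tuples_Suc)

lemma tuples_0: "xs \<in> tuples M 0 \<longleftrightarrow> xs = []"
  by (auto simp: tuples_def)

lemmas tuples_simps = tuples_Suc tuples_numeral tuples_0

lemma tuples_1: "tuples M (Suc 0) = points (carrier M)"
  by (auto simp: tuples_simps points_def)

locale rational_subgroup =
  fixes G :: "rat set"
  assumes subgroup: "subgroup G rat_group"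
begin

abbreviation M where "M \<equiv> ordered_group_structure G"

lemma carrier_M [simp]: "carrier M = G"
  by (simp add: ordered_group_structure_def)

lemma zero_mem: "0 \<in> G"
  using subgroup.one_closed[OF subgroup] by (simp add: rat_group_def)

lemma add_mem: "x \<in> G \<Longrightarrow> y \<in> G \<Longrightarrow> x + y \<in> G"
  using subgroup.m_closed[OF subgroup] by (simp add: rat_group_def)

lemma uminus_mem: "x \<in> G \<Longrightarrow> - x \<in> G"
proof -
  assume x: "x \<in> G"
  have "group rat_group"
    by (rule groupI) (auto simp: rat_group_def intro: exI[of _ "- y" for y])
  then have "inv\<^bsub>rat_group\<^esub> x = - x"
    by (rule group.inv_equality) (auto simp: rat_group_def)
  then show ?thesis using subgroup.m_inv_closed[OF subgroup x] by simp
qed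

lemma diff_mem: "x \<in> G \<Longrightarrow> y \<in> G \<Longrightarrow> x - y \<in> G"
  using add_mem[OF _ uminus_mem] by fastforce

lemma of_nat_mult_mem: "x \<in> G \<Longrightarrow> of_nat n * x \<in> G"
  by (induction n) (auto simp: zero_mem add_mem distrib_right)

lemma of_int_mult_mem: "x \<in> G \<Longrightarrow> of_int k * x \<in> G"
  using of_nat_mult_mem uminus_mem
  by (cases k rule: int_cases2) (auto simp del: of_nat_Suc)

lemma M_simps [simp]:
  "fun_arity M f = 2" "rel_arity M r = 2"
  "fun_interp M f ts = ts ! 0 + ts ! 1" "rel_interp M r ts \<longleftrightarrow> ts ! 0 < ts ! 1"
  by (simp_all add: ordered_group_structure_def)

lemma wf_multiple: "wf_fo_term M t \<Longrightarrow> wf_fo_term M (multiple n t)"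
  by (induction n) auto

lemma eval_multiple: "eval_fo_term M e (multiple n t) = of_nat (Suc n) * eval_fo_term M e t"
  by (induction n) (auto simp: algebra_simps)

lemma definable_above:
  assumes "c \<in> G"
  shows "definable M (Suc 0) (points {x \<in> G. c < of_nat (Suc n) * x})"
  by (rule definableI[where \<phi> = "Rel Less [Var 1, multiple n (Var 0)]" and e = "\<lambda>_. c"])
    (use assms in \<open>auto simp: wf_multiple eval_multiple tuples_simps points_def simp del: of_nat_Suc\<close>)

lemma definable_affine_graph:
  assumes c: "c \<in> G" and k: "k \<noteq> 0"
  shows "definable M 2 {[x, c + of_int k * x] | x. x \<in> G}"
proof -
  have mem: "c + of_int k * x \<in> G" if "x \<in> G" for x
    using that by (intro add_mem[OF c] of_int_mult_mem)
  \<comment> \<open>Terms have positive coefficients only; for negative \<open>k\<close> the term in \<open>x\<close> changes sides.\<close>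
  show ?thesis
  proof (cases "k > 0")
    case True
    then obtain n where "k = int (Suc n)"
      using gr0_implies_Suc zero_less_imp_eq_int by metis
    then have k': "(of_int k :: rat) = of_nat (Suc n)"
      by (metis of_int_of_nat_eq)
    show ?thesis
      unfolding k'
      by (rule definableI[where \<phi> = "Eq (Var 1) (App Plus [Var 2, multiple n (Var 0)])" and e = "\<lambda>_. c"])
        (use c in \<open>auto simp: mem[unfolded k'] wf_multiple eval_multiple tuples_simps simp del: of_nat_Suc\<close>)
  next
    case False
    with k have "- k > 0" by simp
    then obtain n where "- k = int (Suc n)"
      using gr0_implies_Suc zero_less_imp_eq_int by metis
    then have k': "(of_int k :: rat) = - of_nat (Suc n)"
      by (metis minus_minus of_int_minus of_int_of_nat_eq)
    have mem': "c - of_nat (Suc n) * x \<in> G" if "x \<in> G" for x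
      using mem[OF that] by (simp add: k' algebra_simps)
    show ?thesis
      unfolding k'
      by (rule definableI[where \<phi> = "Eq (Var 2) (App Plus [Var 1, multiple n (Var 0)])" and e = "\<lambda>_. c"])
        (use c in \<open>auto simp: mem' wf_multiple eval_multiple tuples_simps simp del: of_nat_Suc\<close>)
  qed
qed

text \<open>
  When \<open>pG \<noteq> G\<close>, a coset of \<open>pG\<close> is the image of \<open>G\<close> under an affine map but not a finite union of
  points and intervals, so a quantifier is needed to define it: the image is a projection of the graph.
\<close>

lemma
  assumes A: "definable M (Suc 0) (points A)" and c: "c \<in> G" and k: "k \<noteq> 0"
  defines "f \<equiv> \<lambda>x. c + of_int k * x"
  shows definable_affine_image: "definable M (Suc 0) (points (f ` A))"
    and def_isomorphic_affine_image: "def_isomorphic M (points A) (points (f ` A))"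
proof -
  have AG: "A \<subseteq> G" using definable_subset[OF A] by (auto simp: tuples_1 points_def)
  have fG: "f x \<in> G" if "x \<in> G" for x
    using that c by (simp add: f_def add_mem of_int_mult_mem)
  define \<Gamma> where "\<Gamma> = {[x, f x] | x. x \<in> A}"
  have "\<Gamma> = {[x, f x] | x. x \<in> G} \<inter> {xs \<in> tuples M 2. map (\<lambda>i. xs ! i) [0..<Suc 0] \<in> points A}"
    using AG by (auto simp: \<Gamma>_def tuples_simps fG subset_iff)
  then have \<Gamma>: "definable M 2 \<Gamma>"
    using definable_Int[OF definable_affine_graph[OF c k] definable_pullback[OF A, of "\<lambda>i. i" 2]]
    by (simp add: f_def)
  \<comment> \<open>The projection forgets the last coordinate, so the coordinates of the graph are exchanged.\<close>
  define \<Delta> where "\<Delta> = {xs \<in> tuples M (Suc (Suc 0)). map (\<lambda>i. xs ! (1 - i)) [0..<2] \<in> \<Gamma>}"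
  have "definable M (Suc (Suc 0)) \<Delta>"
    unfolding \<Delta>_def by (rule definable_pullback[OF \<Gamma>]) (auto simp: inj_on_def)
  then have "definable M (Suc 0) {xs \<in> tuples M (Suc 0). \<exists>a\<in>G. xs @ [a] \<in> \<Delta>}"
    using definable_projection[of M "Suc 0" \<Delta>] by simp
  moreover have "[y] @ [x] \<in> \<Delta> \<longleftrightarrow> x \<in> A \<and> y = f x" for x y
    using AG by (auto simp: \<Delta>_def \<Gamma>_def tuples_simps upt_rec numeral_2_eq_2 fG subset_iff)
  then have "{xs \<in> tuples M (Suc 0). \<exists>a\<in>G. xs @ [a] \<in> \<Delta>} = points (f ` A)"
    using AG by (auto simp: tuples_1 points_def fG subset_iff image_iff)
  ultimately show img: "definable M (Suc 0) (points (f ` A))" by simp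
  have "f x = f y \<longleftrightarrow> x = y" for x y using k by (simp add: f_def)
  then have "bij_betw (\<lambda>xs. [f (xs ! 0)]) (points A) (points (f ` A))"
    by (simp add: bij_betw_def inj_on_def points_def image_image)
  moreover have "{x @ [f (x ! 0)] | x. x \<in> points A} = \<Gamma>"
    by (auto simp: \<Gamma>_def points_def)
  ultimately show "def_isomorphic M (points A) (points (f ` A))"
    using definable_in_Def[OF A] definable_in_Def[OF img] definable_in_Def[OF \<Gamma>]
    by (intro def_isomorphicI[where f = "\<lambda>xs. [f (xs ! 0)]"]) (simp_all only:)
qed


section \<open>The basic classes\<close>

abbreviation K where "K \<equiv> K0_kernel M"

abbreviation one_class where "one_class \<equiv> frag_of (tuples M 0)"

abbreviation line where "line \<equiv> points G"

definition positive where "positive = points {x \<in> G. 0 < x}"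

lemma definable_line: "definable M (Suc 0) line"
  using definable_tuples[of 0 M "Suc 0"] by (simp add: zero_mem tuples_1)

lemma definable_positive: "definable M (Suc 0) positive"
  using definable_above[OF zero_mem, of 0] by (simp add: positive_def)

lemma positive_in_Def: "positive \<in> Def M"
  by (rule definable_in_Def[OF definable_positive])

lemma times_class_K: "X \<in> Def M \<Longrightarrow> c \<in> K \<Longrightarrow> times_class X c \<in> K"
  by (rule times_class_K0_kernel[of 0]) (auto simp: zero_mem)

lemma tuple_times_unit: "tuple_times X (tuples M 0) = X"
  by (auto simp: tuple_times_def tuples_def)

lemma definable_origin: "definable M (Suc 0) (points {0})"
  by (rule definableI[where \<phi> = "Eq (Var 0) (Var 1)" and e = "\<lambda>_. 0"])
    (auto simp: zero_mem tuples_simps points_def)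

lemma origin_class: "frag_of (points {0}) - one_class \<in> K"
proof (rule K0_kernel_iso)
  have "bij_betw (\<lambda>_. []) (points {0 :: rat}) (tuples M 0)"
    by (auto simp: bij_betw_def points_def tuples_simps)
  moreover have "{x @ [] | x. x \<in> points {0 :: rat}} = points {0}"
    by (auto simp: points_def)
  ultimately show "def_isomorphic M (points {0}) (tuples M 0)"
    using definable_in_Def[OF definable_origin] definable_in_Def[OF definable_tuples[of 0 M 0]] zero_mem
    by (intro def_isomorphicI[where f = "\<lambda>_. []"]) simp_all
qed

text \<open>
  \<open>G\<close> is cut at \<open>0\<close>, and negation maps the positive half-line onto the negative one.
\<close>

lemma line_class: "frag_of line - (frag_of positive + frag_of positive + one_class) \<in> K"
proof -
  define N where "N = (\<lambda>x. 0 + of_int (- 1) * x) ` {x \<in> G. 0 < x}"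
  have N: "definable M (Suc 0) (points N)"
    unfolding N_def by (rule definable_affine_image[OF _ zero_mem])
      (use definable_positive in \<open>auto simp: positive_def\<close>)
  have "def_isomorphic M positive (points N)"
    unfolding N_def positive_def by (rule def_isomorphic_affine_image[OF _ zero_mem])
      (use definable_positive in \<open>auto simp: positive_def\<close>)
  then have iso: "frag_of positive - frag_of (points N) \<in> K"
    by (rule K0_kernel_iso)
  have "positive \<inter> points N = {}"
    unfolding positive_def by (rule points_Int_empty) (auto simp: N_def)
  then have PN: "frag_of (positive \<union> points N) - (frag_of positive + frag_of (points N)) \<in> K"
    by (rule K0_kernel_Un[OF definable_positive N])
  have G_eq: "line = (positive \<union> points N) \<union> points {0}"
  proof -
    have "x \<in> N" if "x \<in> G" "x < 0" for x
      using that uminus_mem[of x] by (auto simp: N_def intro!: image_eqI[of _ _ "- x"])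
    moreover have "N \<subseteq> G"
      using uminus_mem by (auto simp: N_def)
    ultimately have "G = {x \<in> G. 0 < x} \<union> N \<union> {0}"
      using zero_mem by fastforce
    then show ?thesis by (metis points_Un positive_def)
  qed
  have "(positive \<union> points N) \<inter> points {0} = {}"
    by (auto simp: positive_def points_def N_def)
  then have "frag_of line - (frag_of (positive \<union> points N) + frag_of (points {0})) \<in> K"
    unfolding G_eq by (rule K0_kernel_Un[OF definable_Un[OF definable_positive N] definable_origin])
  from K0_kernel_diff[OF K0_kernel_add[OF K0_kernel_add[OF this PN] origin_class] iso]
  show ?thesis by (simp add: algebra_simps)
qed

text \<open>
  The triangle \<open>0 < y < x\<close> is mapped onto the quadrant by \<open>(x, y) \<mapsto> (x - y, y)\<close>, and symmetrically for
  the other triangle.  With the diagonal this gives \<open>P\<^sup>2 = 2P\<^sup>2 + P\<close>.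
\<close>

lemma quadrant_class: "frag_of (tuple_times positive positive) + frag_of positive \<in> K"
proof -
  define Q where "Q = tuple_times positive positive"
  define L where "L = {[x, y] | x y. x \<in> G \<and> y \<in> G \<and> 0 < y \<and> y < x}"
  define U where "U = {[x, y] | x y. x \<in> G \<and> y \<in> G \<and> 0 < x \<and> x < y}"
  define D where "D = {[x, x] | x. x \<in> G \<and> 0 < x}"
  have Q_eq: "Q = {[x, y] | x y. x \<in> G \<and> y \<in> G \<and> 0 < x \<and> 0 < y}"
    by (auto simp: Q_def positive_def tuple_times_points)
  have L: "definable M 2 L"
    by (rule definableI[where \<phi> = "Conj (Rel Less [Var 2, Var 1]) (Rel Less [Var 1, Var 0])" and e = "\<lambda>_. 0"])
      (auto simp: L_def tuples_simps zero_mem)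
  have U: "definable M 2 U"
    by (rule definableI[where \<phi> = "Conj (Rel Less [Var 2, Var 0]) (Rel Less [Var 0, Var 1])" and e = "\<lambda>_. 0"])
      (auto simp: U_def tuples_simps zero_mem)
  have D: "definable M 2 D"
    by (rule definableI[where \<phi> = "Conj (Rel Less [Var 2, Var 0]) (Eq (Var 0) (Var 1))" and e = "\<lambda>_. 0"])
      (auto simp: D_def tuples_simps zero_mem)
  have Q: "Q \<in> Def M"
    unfolding Q_def by (rule tuple_times_in_Def[OF positive_in_Def positive_in_Def])
  have split: "frag_of Q - (frag_of (L \<union> U) + frag_of D) \<in> K"
  proof -
    have "Q = (L \<union> U) \<union> D" by (auto simp: Q_eq L_def U_def D_def)
    moreover have "(L \<union> U) \<inter> D = {}" by (auto simp: L_def U_def D_def)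
    ultimately show ?thesis using K0_kernel_Un[OF definable_Un[OF L U] D] by simp
  qed
  have split': "frag_of (L \<union> U) - (frag_of L + frag_of U) \<in> K"
    by (rule K0_kernel_Un[OF L U]) (auto simp: L_def U_def)
  have "frag_of L - frag_of Q \<in> K"
  proof (rule K0_kernel_iso)
    define f :: "rat list \<Rightarrow> rat list" where "f xs = [xs ! 0 - xs ! 1, xs ! 1]" for xs
    have "bij_betw f L Q"
      by (rule bij_betw_byWitness[where f' = "\<lambda>xs. [xs ! 0 + xs ! 1, xs ! 1]"])
        (auto simp: f_def L_def Q_eq add_mem diff_mem)
    moreover have "definable M 4 {xs @ f xs | xs. xs \<in> L}"
      by (rule definableI[where e = "\<lambda>_. 0" and \<phi> =
            "Conj (Conj (Rel Less [Var 4, Var 1]) (Rel Less [Var 1, Var 0]))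
              (Conj (Eq (App Plus [Var 2, Var 1]) (Var 0)) (Eq (Var 3) (Var 1)))"])
        (auto simp: f_def L_def tuples_simps zero_mem diff_mem)
    ultimately show "def_isomorphic M L Q"
      using definable_in_Def L Q by (intro def_isomorphicI) blast+
  qed
  moreover have "frag_of U - frag_of Q \<in> K"
  proof (rule K0_kernel_iso)
    define f :: "rat list \<Rightarrow> rat list" where "f xs = [xs ! 0, xs ! 1 - xs ! 0]" for xs
    have "bij_betw f U Q"
      by (rule bij_betw_byWitness[where f' = "\<lambda>xs. [xs ! 0, xs ! 1 + xs ! 0]"])
        (auto simp: f_def U_def Q_eq add_mem diff_mem)
    moreover have "definable M 4 {xs @ f xs | xs. xs \<in> U}"
      by (rule definableI[where e = "\<lambda>_. 0" and \<phi> =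
            "Conj (Conj (Rel Less [Var 4, Var 0]) (Rel Less [Var 0, Var 1]))
              (Conj (Eq (Var 2) (Var 0)) (Eq (App Plus [Var 3, Var 0]) (Var 1)))"])
        (auto simp: f_def U_def tuples_simps zero_mem diff_mem)
    ultimately show "def_isomorphic M U Q"
      using definable_in_Def U Q by (intro def_isomorphicI) blast+
  qed
  moreover have "frag_of positive - frag_of D \<in> K"
  proof (rule K0_kernel_iso)
    define f :: "rat list \<Rightarrow> rat list" where "f xs = [xs ! 0, xs ! 0]" for xs
    have "bij_betw f positive D"
      by (rule bij_betw_byWitness[where f' = "\<lambda>xs. [xs ! 0]"])
        (auto simp: f_def D_def positive_def points_def)
    moreover have "definable M 3 {xs @ f xs | xs. xs \<in> positive}"
      by (rule definableI[where e = "\<lambda>_. 0" and \<phi> =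
            "Conj (Rel Less [Var 3, Var 0]) (Conj (Eq (Var 0) (Var 1)) (Eq (Var 0) (Var 2)))"])
        (auto simp: f_def positive_def points_def tuples_simps zero_mem)
    ultimately show "def_isomorphic M positive D"
      using definable_in_Def positive_in_Def D by (intro def_isomorphicI) blast+
  qed
  ultimately have "(frag_of positive - frag_of D) - (frag_of Q - (frag_of (L \<union> U) + frag_of D))
      - (frag_of (L \<union> U) - (frag_of L + frag_of U))
      - (frag_of L - frag_of Q) - (frag_of U - frag_of Q) \<in> K"
    using K0_kernel_diff[OF K0_kernel_diff[OF K0_kernel_diff[OF K0_kernel_diff[OF _ split] split']]]
    by blast
  then show ?thesis by (simp add: Q_def algebra_simps)
qed

text \<open>
  \<open>P g = P (2P + 1) = 2(P\<^sup>2 + P) - P = -P\<close>.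
\<close>

lemma half_plane_class: "frag_of (tuple_times positive line) + frag_of positive \<in> K"
proof -
  have "times_class positive (frag_of line - (frag_of positive + frag_of positive + one_class)) \<in> K"
    by (rule times_class_K[OF positive_in_Def line_class])
  from K0_kernel_add[OF this K0_kernel_add[OF quadrant_class quadrant_class]]
  show ?thesis by (simp add: times_class_simps tuple_times_unit algebra_simps)
qed

text \<open>
  Immediate from \<open>1 = g - 2P\<close>; this reduces statements about the unit to statements about \<open>g\<close> and \<open>P\<close>.
\<close>

lemma coefficient_one_class:
  assumes "frag_cmul k (frag_of positive) \<in> K" "frag_cmul k (frag_of line) \<in> K"
  shows "frag_cmul k one_class \<in> K"
proof -
  have "frag_cmul k (frag_of line) - (frag_cmul k (frag_of positive) + frag_cmul k (frag_of positive))
      - frag_cmul k (frag_of line - (frag_of positive + frag_of positive + one_class)) \<in> K"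
    by (intro K0_kernel_diff K0_kernel_add assms K0_kernel_cmul line_class)
  then show ?thesis
    by (simp add: frag_cmul_distrib2 frag_cmul_diff_distrib2 algebra_simps)
qed


section \<open>Primes by which the group is not divisible\<close>

text \<open>
  \<open>G/pG\<close> is a vector space over the field with \<open>p\<close> elements, in which \<open>m\<close> is invertible.
\<close>

lemma coprime_multiple_mem:
  assumes "coprime m (int p)" "c \<in> G" "x \<in> G" "of_int m * c = of_nat p * x"
  shows "\<exists>y\<in>G. of_nat p * y = c"
proof -
  obtain u v where "u * m + v * int p = 1" using assms(1) bezout_int[of m "int p"] by auto
  then have 1: "of_int u * of_int m + of_int v * of_nat p = (1 :: rat)"
    by (metis of_int_1 of_int_add of_int_mult of_int_of_nat_eq)
  have "c = (of_int u * of_int m + of_int v * of_nat p) * c" by (simp add: 1)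
  also have "\<dots> = of_int u * (of_int m * c) + of_nat p * (of_int v * c)" by (simp add: algebra_simps)
  also have "\<dots> = of_nat p * (of_int u * x + of_int v * c)" unfolding assms(4) by (simp add: algebra_simps)
  finally show ?thesis using assms(2,3) add_mem of_int_mult_mem by metis
qed

text \<open>
  \<open>G/pG\<close> is generated by any nonzero element, since two elements \<open>x\<close> and \<open>c\<close> of \<open>G\<close> satisfy a relation
  \<open>r x = s c\<close> with coprime integers \<open>r\<close> and \<open>s\<close>.  If \<open>p\<close> divided \<open>r\<close>, then \<open>s\<close> would be invertible modulo
  \<open>p\<close> and \<open>c\<close> would lie in \<open>pG\<close>; so \<open>r\<close> is invertible modulo \<open>p\<close> and \<open>x\<close> is congruent to a multiple of
  \<open>c\<close>.
\<close>

lemma ex_coset_representative: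
  assumes p: "prime p" and c: "c \<in> G" and nc: "\<And>y. y \<in> G \<Longrightarrow> of_nat p * y \<noteq> c" and x: "x \<in> G"
  shows "\<exists>i<p. \<exists>y\<in>G. x = of_nat i * c + of_nat p * y"
proof -
  have c0: "c \<noteq> 0" using nc[OF zero_mem] by simp
  obtain s r where sr: "quotient_of (x / c) = (s, r)" by (meson surj_pair)
  have r: "r > 0" "coprime s r" "x / c = of_int s / of_int r"
    using quotient_of_denom_pos[OF sr] quotient_of_coprime[OF sr] quotient_of_div[OF sr] by auto
  then have eq: "of_int r * x = of_int s * c" using c0 by (simp add: field_simps)
  have "\<not> int p dvd r"
  proof
    assume dvd: "int p dvd r"
    then obtain t where t: "r = int p * t" by blast
    have "coprime s (int p)" using r(2) dvd by (meson coprime_divisors dvd_refl)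
    moreover have "of_int s * c = of_nat p * (of_int t * x)" using eq t by (simp add: algebra_simps)
    ultimately show False using coprime_multiple_mem[of s p c "of_int t * x"] c x nc of_int_mult_mem by blast
  qed
  moreover have "prime (int p)" using p by simp
  ultimately have "coprime r (int p)" using prime_imp_coprime coprime_commute by blast
  then obtain u v where "u * r + v * int p = 1" using bezout_int[of r "int p"] by auto
  then have 1: "of_int u * of_int r + of_int v * of_nat p = (1 :: rat)"
    by (metis of_int_1 of_int_add of_int_mult of_int_of_nat_eq)
  \<comment> \<open>As \<open>u\<close> inverts \<open>r\<close> modulo \<open>p\<close>, \<open>x\<close> is congruent to \<open>u r x = u s c\<close>.\<close>
  define i where "i = nat ((u * s) mod int p)"
  have ip: "i < p" using p prime_gt_0_nat[OF p] by (simp add: i_def nat_less_iff)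
  have "int i + int p * ((u * s) div int p) = u * s"
    using p prime_gt_0_nat[OF p] by (simp add: i_def)
  then have us: "of_nat i + of_nat p * of_int ((u * s) div int p) = (of_int u * of_int s :: rat)"
    by (metis of_int_add of_int_mult of_int_of_nat_eq)
  have "x = (of_int u * of_int r + of_int v * of_nat p) * x" by (simp add: 1)
  also have "\<dots> = of_int u * (of_int r * x) + of_nat p * (of_int v * x)" by (simp add: algebra_simps)
  also have "\<dots> = (of_int u * of_int s) * c + of_nat p * (of_int v * x)" by (simp add: eq)
  also have "\<dots> = of_nat i * c + of_nat p * (of_int ((u * s) div int p) * c + of_int v * x)"
    unfolding us[symmetric] by (simp add: algebra_simps)
  finally show ?thesis using ip add_mem of_int_mult_mem c x by blast
qed

text \<open>
  The sets \<open>i c + pG\<close> with \<open>i < p\<close> partition \<open>G\<close> into \<open>p\<close> definable copies of \<open>G\<close>, so \<open>g = p g\<close>.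
\<close>

lemma line_multiple_class:
  assumes p: "prime p" and np: "\<not> p_divisible p G"
  shows "frag_cmul (int (p - 1)) (frag_of line) \<in> K"
proof -
  obtain c where c: "c \<in> G" and nc: "\<And>y. y \<in> G \<Longrightarrow> of_nat p * y \<noteq> c"
    using np by (auto simp: p_divisible_def)
  define C where "C i = (\<lambda>x. of_nat i * c + of_int (int p) * x) ` G" for i
  have p0: "int p \<noteq> 0" using p by auto
  have C: "definable M (Suc 0) (points (C i))" "def_isomorphic M line (points (C i))" for i
    unfolding C_def
    using definable_affine_image[OF definable_line of_nat_mult_mem[OF c] p0]
      def_isomorphic_affine_image[OF definable_line of_nat_mult_mem[OF c] p0] by blast+
  have disj: "C i \<inter> C j = {}" if "i < j" "j < p" for i j
  proof (rule ccontr)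
    assume "C i \<inter> C j \<noteq> {}"
    then obtain x y where xy: "x \<in> G" "y \<in> G"
      "of_nat i * c + of_nat p * x = of_nat j * c + of_nat p * y" by (auto simp: C_def)
    then have "of_int (int (j - i)) * c = of_nat p * (x - y)"
      using that by (simp add: of_nat_diff algebra_simps)
    moreover have "\<not> p dvd j - i"
      using that by (auto dest!: dvd_imp_le)
    then have "coprime (int (j - i)) (int p)"
      using prime_imp_coprime[OF p] by (simp only: coprime_int_iff coprime_commute[of _ p])
    ultimately show False using coprime_multiple_mem[OF _ c diff_mem[OF xy(1,2)]] nc by blast
  qed
  have "definable M (Suc 0) (points (\<Union>i<k. C i)) \<and>
      frag_of (points (\<Union>i<k. C i)) - frag_cmul (int k) (frag_of line) \<in> K" if "k \<le> p" for k
    using that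
  proof (induction k)
    case 0
    \<comment> \<open>The empty set is its own disjoint union with itself, so its class vanishes.\<close>
    have e: "definable M (Suc 0) {}" by (rule definable_empty[of 0]) (simp add: zero_mem)
    then have "- (frag_of {} - (frag_of {} + frag_of {})) \<in> K"
      using K0_kernel_uminus[OF K0_kernel_Un[OF e e]] by simp
    then show ?case using e by (simp add: points_def)
  next
    case (Suc k)
    then have IH: "definable M (Suc 0) (points (\<Union>i<k. C i))"
      "frag_of (points (\<Union>i<k. C i)) - frag_cmul (int k) (frag_of line) \<in> K" by auto
    have eq: "points (\<Union>i<Suc k. C i) = points (\<Union>i<k. C i) \<union> points (C k)"
      by (simp add: lessThan_Suc points_Un Un_commute)
    have "points (\<Union>i<k. C i) \<inter> points (C k) = {}"
      using disj[of _ k] Suc.prems by (intro points_Int_empty) auto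
    then have "frag_of (points (\<Union>i<Suc k. C i)) - (frag_of (points (\<Union>i<k. C i)) + frag_of (points (C k))) \<in> K"
      unfolding eq by (rule K0_kernel_Un[OF IH(1) C(1)])
    from K0_kernel_diff[OF K0_kernel_add[OF this IH(2)] K0_kernel_iso[OF C(2)[of k]]]
    show ?case using definable_Un[OF IH(1) C(1)] unfolding eq
      by (simp add: frag_cmul_distrib algebra_simps)
  qed
  from this[of p] have "frag_of (points (\<Union>i<p. C i)) - frag_cmul (int p) (frag_of line) \<in> K" by simp
  moreover have "(\<Union>i<p. C i) = G"
  proof (intro equalityI subsetI)
    fix x assume "x \<in> G"
    from ex_coset_representative[OF p c nc this] show "x \<in> (\<Union>i<p. C i)" by (auto simp: C_def)
  qed (auto simp: C_def add_mem of_nat_mult_mem c)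
  ultimately have "- (frag_of line - frag_cmul (int p) (frag_of line)) \<in> K"
    using K0_kernel_uminus by metis
  then show ?thesis
    using prime_gt_0_nat[OF p] by (simp add: of_nat_diff frag_cmul_diff_distrib)
qed

text \<open>
  From \<open>(p - 1) g = 0\<close> follows \<open>(p - 1) P = -(p - 1) P g = 0\<close>, whence \<open>p - 1 = 0\<close>.
\<close>

lemma one_class_multiple:
  assumes p: "prime p" and np: "\<not> p_divisible p G"
  shows "frag_cmul (int (p - 1)) one_class \<in> K"
proof (rule coefficient_one_class)
  let ?k = "int (p - 1)"
  show l: "frag_cmul ?k (frag_of line) \<in> K" by (rule line_multiple_class[OF assms])
  have "frag_cmul ?k (frag_of (tuple_times positive line) + frag_of positive)
      - times_class positive (frag_cmul ?k (frag_of line)) \<in> K"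
    by (intro K0_kernel_diff K0_kernel_cmul half_plane_class times_class_K positive_in_Def l)
  then show "frag_cmul ?k (frag_of positive) \<in> K"
    by (simp add: times_class_simps frag_cmul_distrib2)
qed

lemma divide_mem:
  assumes "n > 0" "\<And>q. prime q \<Longrightarrow> q dvd n \<Longrightarrow> p_divisible q G" "x \<in> G"
  shows "\<exists>y\<in>G. of_nat n * y = x"
  using assms
proof (induction n arbitrary: x rule: less_induct)
  case (less n)
  show ?case
  proof (cases "n = 1")
    case True
    then show ?thesis using less by auto
  next
    case False
    then obtain q where q: "prime q" "q dvd n" using prime_factor_nat[of n] by blast
    then obtain m where m: "n = q * m" by blast
    then obtain z where z: "z \<in> G" "of_nat q * z = x"
      using less.prems q unfolding p_divisible_def by blast
    have "m < n" "m > 0" using m less.prems(1) prime_gt_1_nat[OF q(1)] by auto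
    then obtain y where "y \<in> G" "of_nat m * y = z"
      using less.IH[of m z] less.prems(2) m z by auto
    then show ?thesis using z m by (auto simp: mult.assoc)
  qed
qed

text \<open>
  Let \<open>A\<close> be the class of the part \<open>c < p x\<close> of \<open>G\<close>.  Then \<open>g = 2A\<close>, and if \<open>2m = 0\<close> then
  \<open>m g = (2m) A = 0\<close> and \<open>m P = -m P g = -(2m) P A = 0\<close>, so that \<open>m = m g - 2m P = 0\<close>.
\<close>

lemma halve_one_class:
  assumes p: "prime p" "p \<noteq> 2" and np: "\<not> p_divisible p G"
    and least: "\<And>q. prime q \<Longrightarrow> q < p \<Longrightarrow> p_divisible q G"
    and m: "frag_cmul (m + m) one_class \<in> K"
  shows "frag_cmul m one_class \<in> K"
proof -
  obtain c where c: "c \<in> G" and nc: "\<And>y. y \<in> G \<Longrightarrow> of_nat p * y \<noteq> c"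
    using np by (auto simp: p_divisible_def)
  have p2: "p > 2" using p prime_ge_2_nat[of p] by simp
  then have k: "- int (p - 1) \<noteq> 0" by simp
  define A where "A = {x \<in> G. c < of_nat p * x}"
  define f where "f x = c + of_int (- int (p - 1)) * x" for x :: rat
  obtain n where n: "p = Suc n" using p2 by (cases p) auto
  have A: "definable M (Suc 0) (points A)"
    unfolding A_def n by (rule definable_above[OF c])
  have fA: "f ` A = {x \<in> G. of_nat p * x < c}"
  proof (intro equalityI subsetI)
    have pos: "of_nat (p - 1) > (0 :: rat)" using p2 by simp
    \<comment> \<open>The map reflects at \<open>c / p\<close>, a fixed point outside \<open>G\<close>, and stretches by \<open>p - 1\<close>.\<close>
    have pf: "of_nat p * f x - c = of_nat (p - 1) * (c - of_nat p * x)" for x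
      using p2 by (simp add: f_def of_nat_diff algebra_simps)
    have less_iff: "of_nat p * f x < c \<longleftrightarrow> c < of_nat p * x" for x
      using pf[of x] pos by (metis diff_less_0_iff_less mult_less_0_iff not_less_iff_gr_or_eq)
    have f_mem: "f x \<in> G" if "x \<in> G" for x
      unfolding f_def by (intro add_mem c of_int_mult_mem that)
    fix y
    show "y \<in> {x \<in> G. of_nat p * x < c}" if "y \<in> f ` A"
      using that less_iff f_mem by (auto simp: A_def)
    assume y: "y \<in> {x \<in> G. of_nat p * x < c}"
    \<comment> \<open>Surjectivity is where the minimality of \<open>p\<close> enters.\<close>
    have "p_divisible q G" if "prime q" "q dvd p - 1" for q
      using that p2 by (intro least) (auto dest!: dvd_imp_le)
    then obtain x where x: "x \<in> G" "of_nat (p - 1) * x = c - y"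
      using divide_mem[of "p - 1" "c - y"] p2 y c diff_mem by auto
    then have "y = f x" by (simp add: f_def)
    then show "y \<in> f ` A" using x y less_iff by (auto simp: A_def)
  qed
  have B: "definable M (Suc 0) (points (f ` A))" "def_isomorphic M (points A) (points (f ` A))"
    unfolding f_def using definable_affine_image[OF A c k] def_isomorphic_affine_image[OF A c k] by blast+
  have "x \<in> A \<or> x \<in> f ` A" if "x \<in> G" for x
    using nc[OF that] that unfolding fA unfolding A_def by force
  moreover have "A \<subseteq> G" by (auto simp: A_def)
  moreover have "f ` A \<subseteq> G" unfolding fA by auto
  ultimately have "G = A \<union> f ` A" by blast
  then have "line = points A \<union> points (f ` A)" by (metis points_Un)
  moreover have "points A \<inter> points (f ` A) = {}"
    unfolding fA by (rule points_Int_empty) (auto simp: A_def)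
  ultimately have "frag_of line - (frag_of (points A) + frag_of (points (f ` A))) \<in> K"
    using K0_kernel_Un[OF A B(1)] by simp
  from K0_kernel_diff[OF this K0_kernel_iso[OF B(2)]]
  have double: "frag_of line - (frag_of (points A) + frag_of (points A)) \<in> K"
    by (simp add: algebra_simps)
  have AD: "points A \<in> Def M" by (rule definable_in_Def[OF A])
  show ?thesis
  proof (rule coefficient_one_class)
    have "frag_cmul m (frag_of (tuple_times positive line) + frag_of positive)
        - frag_cmul m (times_class positive (frag_of line - (frag_of (points A) + frag_of (points A))))
        - times_class (tuple_times positive (points A)) (frag_cmul (m + m) one_class) \<in> K"
      by (intro K0_kernel_diff K0_kernel_cmul half_plane_class times_class_K positive_in_Def
          tuple_times_in_Def AD double m)
    then show "frag_cmul m (frag_of positive) \<in> K"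
      unfolding times_class_simps tuple_times_unit frag_cmul_distrib frag_cmul_distrib2
        frag_cmul_diff_distrib2
      by (simp add: algebra_simps)
    have "frag_cmul m (frag_of line - (frag_of (points A) + frag_of (points A)))
        + times_class (points A) (frag_cmul (m + m) one_class) \<in> K"
      by (intro K0_kernel_add K0_kernel_cmul times_class_K AD double m)
    then show "frag_cmul m (frag_of line) \<in> K"
      unfolding times_class_simps tuple_times_unit frag_cmul_distrib frag_cmul_distrib2
        frag_cmul_diff_distrib2
      by (simp add: algebra_simps)
  qed
qed

text \<open>
  The least \<open>n > 0\<close> with \<open>n = 0\<close> in the ring divides \<open>p - 1\<close> whenever \<open>G\<close> is not
  \<open>p\<close>-divisible, so it has no odd prime factor, and it is odd because otherwise \<open>n/2\<close> would vanish too.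
\<close>

lemma one_class_mem:
  assumes no_q: "\<not> (\<exists>q::nat. prime q \<and> odd q \<and>
      (\<forall>p::nat. prime p \<and> p \<notin> divisible_primes G \<longrightarrow> q dvd p - 1))"
  shows "one_class \<in> K"
proof -
  define I where "I n \<longleftrightarrow> frag_cmul (int n) one_class \<in> K" for n
  define bad where "bad p \<longleftrightarrow> prime p \<and> \<not> p_divisible p G" for p
  have bad: "prime p \<and> p \<notin> divisible_primes G \<longleftrightarrow> bad p" for p
    by (auto simp: bad_def divisible_primes_def)
  have I_bad: "I (p - 1)" if "bad p" for p
    using that one_class_multiple by (auto simp: bad_def I_def)
  \<comment> \<open>If \<open>G\<close> were divisible by all primes, every odd prime would vacuously be a common divisor.\<close>
  have "prime (3 :: nat)" "odd (3 :: nat)" by simp_all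
  then obtain p where "bad p" using no_q unfolding bad by blast
  define l where "l = (LEAST p. bad p)"
  have l: "bad l" using \<open>bad p\<close> unfolding l_def by (rule LeastI)
  have least: "p_divisible q G" if "prime q" "q < l" for q
    using not_less_Least[of q bad] that unfolding l_def bad_def by blast
  have "l - 1 > 0" using l prime_gt_1_nat by (auto simp: bad_def)
  define n where "n = (LEAST n. n > 0 \<and> I n)"
  have n: "n > 0" "I n"
    using LeastI[of "\<lambda>n. n > 0 \<and> I n" "l - 1"] I_bad[OF l] \<open>l - 1 > 0\<close> unfolding n_def by auto
  have n_min: "\<not> I k" if "0 < k" "k < n" for k
    using not_less_Least[of k "\<lambda>n. n > 0 \<and> I n"] that unfolding n_def by blast
  have n_dvd: "n dvd k" if "I k" for k
  proof -
    have "frag_cmul (int k) one_class - frag_cmul (int (k div n)) (frag_cmul (int n) one_class) \<in> K"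
      using K0_kernel_diff K0_kernel_cmul that n(2) unfolding I_def by blast
    then have "I (k mod n)"
      by (simp add: I_def frag_cmul_diff_distrib[symmetric] minus_div_mult_eq_mod of_nat_mod
          zmod_int zdiv_int)
    then show ?thesis using n_min[of "k mod n"] n(1) by (auto simp: dvd_eq_mod_eq_0)
  qed
  have "n = 1"
  proof (rule ccontr)
    assume "n \<noteq> 1"
    then obtain q where q: "prime q" "q dvd n" using prime_factor_nat[of n] by blast
    have "q dvd p - 1" if "bad p" for p
      using q(2) n_dvd[OF I_bad[OF that]] by (rule dvd_trans)
    then have "even q" using no_q q(1) unfolding bad by blast
    then have "q = 2" using q(1) using prime_odd_nat[of q] prime_ge_2_nat[of q] by linarith
    then obtain m where m: "n = m + m" using q(2) by (auto simp: mult_2 elim!: dvdE)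
    have "l \<noteq> 2"
    proof
      assume "l = 2"
      then show False using n_dvd[OF I_bad[OF l]] \<open>n \<noteq> 1\<close> by simp
    qed
    then have "I m"
      using halve_one_class[of l "int m"] l least n(2) m by (auto simp: I_def bad_def)
    then show False using n_min[of m] m n(1) by simp
  qed
  then show ?thesis using n(2) by (simp add: I_def)
qed

end

theorem corollary2p6:
  fixes G :: "rat set"
  assumes "subgroup G rat_group"
    and "G \<noteq> UNIV"
    and "\<not> (\<exists>q::nat. prime q \<and> odd q \<and>
               (\<forall>p::nat. prime p \<and> p \<notin> divisible_primes G \<longrightarrow> q dvd p - 1))"
  shows "carrier (K0 (ordered_group_structure G)) = {\<zero>\<^bsub>K0 (ordered_group_structure G)\<^esub>}"
proof -
  interpret rational_subgroup G
    by (rule rational_subgroup.intro[OF assms(1)])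
  show ?thesis
    using K0_trivialI[of 0 M] one_class_mem[OF assms(3)] zero_mem by simp
qed

end
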